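(* Let $\Bbbk$ be an algebraically closed field of characteristic $2$ and let $\mathfrak{u}(\mathfrak{m})$ be the algebra generated by $a,b,c$ with relations $ab+ba=c$, $ac+ca=a$, $bc+cb=b$, $a^4=b^4=0$, $c^2+c=0$. If $0\to V_1\to U\to V_0\to 0$ is an exact sequence of $\mathfrak{u}(\mathfrak{m})$-modules, then $U\simeq V_{\vartheta,\lambda,\mu}$ for some $\vartheta,\lambda,\mu\in\Bbbk$. Moreover $\dim\operatorname{Ext}^1_{\mathfrak{u}(\mathfrak{m})}(V_0,V_1)=2$.
   Context: $V_0$ is the one-dimensional module on which $a,b,c$ act by $0$. $V_1$ is the three-dimensional module with basis $v_1,v_2,v_3$ and action $av_1=v_2$, $av_2=v_3$, $av_3=0$; $bv_1=0$, $bv_2=v_1$, $bv_3=v_2$; $cv_1=v_1$, $cv_2=0$, $cv_3=v_3$. For $\vartheta,\lambda,\mu\in\Bbbk$, $V_{\vartheta,\lambda,\mu}$ is $\Bbbk^4$ with standard basis $e_1,\dots,e_4$ and action $ae_1=\vartheta e_2$, $ae_2=e_3$, $ae_3=e_4$, $ae_4=0$; $be_1=\lambda e_3+\mu e_4$, $be_2=0$, $be_3=e_2$, $be_4=e_3$; $ce_1=\lambda e_4$, $ce_2=e_2$, $ce_3=0$, $ce_4=e_4$. *)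

theory Defs
  imports "HOL-Analysis.Analysis" "HOL-Computational_Algebra.Polynomial" "HOL-Library.Numeral_Type" "HOL-Library.Function_Algebras"
begin

text \<open>Generators a, b, c of the restricted enveloping algebra u(m).\<close>
datatype gen = Ga | Gb | Gc

text \<open>A (finite-dimensional) u(m)-module on k^n, given by the matrices of a, b, c
  (entry (i,j) is the coefficient of e_i in x e_j).  The defining relations of u(m).\<close>
definition is_umod :: "(gen \<Rightarrow> 'k::field ^'n^'n) \<Rightarrow> bool" where
  "is_umod \<rho> \<longleftrightarrow>
     \<rho> Ga ** \<rho> Gb + \<rho> Gb ** \<rho> Ga = \<rho> Gc \<and>
     \<rho> Ga ** \<rho> Gc + \<rho> Gc ** \<rho> Ga = \<rho> Ga \<and>
     \<rho> Gb ** \<rho> Gc + \<rho> Gc ** \<rho> Gb = \<rho> Gb \<and>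
     \<rho> Ga ** \<rho> Ga ** \<rho> Ga ** \<rho> Ga = 0 \<and>
     \<rho> Gb ** \<rho> Gb ** \<rho> Gb ** \<rho> Gb = 0 \<and>
     \<rho> Gc ** \<rho> Gc + \<rho> Gc = 0"

text \<open>F : k^m \<rightarrow> k^n (matrix) is a module homomorphism from (k^m, \<sigma>) to (k^n, \<rho>).\<close>
definition is_umod_hom :: "(gen \<Rightarrow> 'k::field ^'m^'m) \<Rightarrow> (gen \<Rightarrow> 'k^'n^'n) \<Rightarrow> 'k^'m^'n \<Rightarrow> bool" where
  "is_umod_hom \<sigma> \<rho> F \<longleftrightarrow> (\<forall>g. F ** \<sigma> g = \<rho> g ** F)"

definition umod_iso :: "(gen \<Rightarrow> 'k::field ^'m^'m) \<Rightarrow> (gen \<Rightarrow> 'k^'n^'n) \<Rightarrow> bool" where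
  "umod_iso \<sigma> \<rho> \<longleftrightarrow> (\<exists>F::'k^'m^'n. invertible F \<and> is_umod_hom \<sigma> \<rho> F)"

text \<open>The modules V_0, V_1, V_{\<theta>,\<lambda>,\<mu>}.  Basis indices: for type 3 the elements 1,2,3;
  for type 4 the elements 1,2,3,4 (numerals in the residue types, pairwise distinct).\<close>
definition V0 :: "gen \<Rightarrow> 'k::field ^1^1" where
  "V0 g = 0"

definition V1 :: "gen \<Rightarrow> 'k::field ^3^3" where
  "V1 g = (case g of
     Ga \<Rightarrow> (\<chi> i j. if (i = 2 \<and> j = 1) \<or> (i = 3 \<and> j = 2) then 1 else 0)
   | Gb \<Rightarrow> (\<chi> i j. if (i = 1 \<and> j = 2) \<or> (i = 2 \<and> j = 3) then 1 else 0)
   | Gc \<Rightarrow> (\<chi> i j. if (i = 1 \<and> j = 1) \<or> (i = 3 \<and> j = 3) then 1 else 0))"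

definition Vtlm :: "'k::field \<Rightarrow> 'k \<Rightarrow> 'k \<Rightarrow> gen \<Rightarrow> 'k^4^4" where
  "Vtlm th la mu g = (case g of
     Ga \<Rightarrow> (\<chi> i j. if i = 2 \<and> j = 1 then th
                  else if (i = 3 \<and> j = 2) \<or> (i = 4 \<and> j = 3) then 1 else 0)
   | Gb \<Rightarrow> (\<chi> i j. if i = 3 \<and> j = 1 then la else if i = 4 \<and> j = 1 then mu
                  else if (i = 2 \<and> j = 3) \<or> (i = 3 \<and> j = 4) then 1 else 0)
   | Gc \<Rightarrow> (\<chi> i j. if i = 4 \<and> j = 1 then la
                  else if (i = 2 \<and> j = 2) \<or> (i = 4 \<and> j = 4) then 1 else 0))"

text \<open>Ext^1(M,N) computed from extensions: an extension of M by N is N \<oplus> M with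
  block upper triangular action [[N_x, D_x],[0, M_x]]; the cocycles Z are the D making this
  a module, the coboundaries B are those giving split extensions (D_x = N_x h - h M_x).
  Ext^1(M,N) = Z/B, so its dimension is dim Z - dim B.\<close>
definition block_mod :: "(gen \<Rightarrow> 'k::field ^'m^'m) \<Rightarrow> (gen \<Rightarrow> 'k^'n^'n) \<Rightarrow> (gen \<Rightarrow> 'k^'m^'n)
    \<Rightarrow> gen \<Rightarrow> 'k^('n + 'm)^('n + 'm)" where
  "block_mod M N D g = (\<chi> i j. case (i, j) of
       (Inl i', Inl j') \<Rightarrow> N g $ i' $ j'
     | (Inl i', Inr j') \<Rightarrow> D g $ i' $ j'
     | (Inr i', Inl j') \<Rightarrow> 0
     | (Inr i', Inr j') \<Rightarrow> M g $ i' $ j')"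

definition cocycles :: "(gen \<Rightarrow> 'k::field ^'m^'m) \<Rightarrow> (gen \<Rightarrow> 'k^'n^'n) \<Rightarrow> (gen \<Rightarrow> 'k^'m^'n) set" where
  "cocycles M N = {D. is_umod (block_mod M N D)}"

definition coboundaries :: "(gen \<Rightarrow> 'k::field ^'m^'m) \<Rightarrow> (gen \<Rightarrow> 'k^'n^'n) \<Rightarrow> (gen \<Rightarrow> 'k^'m^'n) set" where
  "coboundaries M N = {D. \<exists>h::'k^'m^'n. \<forall>g. D g = N g ** h - h ** M g}"

definition hom_scale :: "'k::field \<Rightarrow> (gen \<Rightarrow> 'k^'m^'n) \<Rightarrow> (gen \<Rightarrow> 'k^'m^'n)" where
  "hom_scale c D = (\<lambda>g. \<chi> i j. c * D g $ i $ j)"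

definition ext1_dim :: "(gen \<Rightarrow> 'k::field ^'m^'m) \<Rightarrow> (gen \<Rightarrow> 'k^'n^'n) \<Rightarrow> nat" where
  "ext1_dim M N = vector_space.dim hom_scale (cocycles M N) - vector_space.dim hom_scale (coboundaries M N)"

end

theory Submission
  imports Defs
begin

text \<open>Both parts are computations with cocycles. An extension of the trivial module V0 by V1 is
  described by the three vectors by which a, b, c move a lift u of the generator of V0 into V1;
  the relations of u(m) impose linear conditions on them, which in characteristic 2 cut out a
  5-dimensional space, while the coboundaries x \<mapsto> x h form a 3-dimensional one, so
  Ext^1(V0, V1) has dimension 2. For a given extension U, changing u by an element h of V1 changes
  the cocycle by a coboundary, and h can be chosen so that a u is a multiple \<theta> v1 of v1. The
  cocycle conditions then force b u = \<lambda> v2 + \<mu> v3 and c u = \<lambda> v3, which in the basis u, v1, v2, v3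
  is exactly the action on V_{\<theta>,\<lambda>,\<mu>}.\<close>

lemma CHAR_2_imp_two_eq_zero: "CHAR('k::field) = 2 \<Longrightarrow> (2::'k) = 0"
  using of_nat_CHAR[where 'a='k] by simp

lemma vector_space_hom_scale: "vector_space (hom_scale :: 'k::field \<Rightarrow> (gen \<Rightarrow> 'k^'m^'n) \<Rightarrow> _)"
  by unfold_locales (auto simp: hom_scale_def fun_eq_iff vec_eq_iff algebra_simps)

lemma dim_range_injective_linear:
  fixes \<phi> :: "'k::field^'p \<Rightarrow> (gen \<Rightarrow> 'k^'m^'n)"
  assumes add: "\<And>x y. \<phi> (x + y) = \<phi> x + \<phi> y"
    and scale: "\<And>c x. \<phi> (c *s x) = hom_scale c (\<phi> x)"
    and "inj \<phi>"
  shows "vector_space.dim hom_scale (range \<phi>) = CARD('p)"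
proof -
  interpret p: finite_dimensional_vector_space_pair_1 "(*s)" cart_basis hom_scale
    by (intro finite_dimensional_vector_space_pair_1.intro vec.finite_dimensional_vector_space_axioms
        vector_space_hom_scale)
  have "Vector_Spaces.linear (*s) hom_scale \<phi>"
    using add scale vector_space_hom_scale by (auto simp: Vector_Spaces.linear_iff vec.vector_space_axioms)
  then have "vector_space.dim hom_scale (range \<phi>) = vec.dim (UNIV :: ('k^'p) set)"
    using p.dim_image_eq[of \<phi> UNIV] \<open>inj \<phi>\<close> by simp
  then show ?thesis by (simp add: card_cart_basis)
qed

lemma umod_hom_mult_vec:
  assumes "is_umod_hom \<sigma> \<rho> F"
  shows "\<rho> g *v (F *v w) = F *v (\<sigma> g *v w)"
  using assms unfolding is_umod_hom_def by (metis matrix_vector_mul_assoc)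

lemma umod_iso_sym:
  assumes "umod_iso \<sigma> \<rho>"
  shows "umod_iso \<rho> \<sigma>"
proof -
  obtain P P' where PP': "P ** P' = mat 1" "P' ** P = mat 1" and hom: "\<And>g. P ** \<sigma> g = \<rho> g ** P"
    using assms unfolding umod_iso_def is_umod_hom_def invertible_def by blast
  have "P' ** \<rho> g = \<sigma> g ** P'" for g
  proof -
    have "P' ** \<rho> g = P' ** \<rho> g ** (P ** P')" by (simp add: PP')
    also have "\<dots> = P' ** (P ** \<sigma> g) ** P'" by (simp add: hom matrix_mul_assoc)
    also have "\<dots> = \<sigma> g ** P'" by (metis PP'(2) matrix_mul_assoc matrix_mul_lid)
    finally show ?thesis .
  qed
  moreover have "invertible P'"
    using PP' unfolding invertible_def by blast
  ultimately show ?thesis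
    unfolding umod_iso_def is_umod_hom_def by blast
qed

definition block_matrix :: "'k::field^'n^'n \<Rightarrow> 'k^'m^'n \<Rightarrow> 'k^'m^'m \<Rightarrow> 'k^('n+'m)^('n+'m)" where
  "block_matrix A B C = (\<chi> i j. case (i, j) of
       (Inl i', Inl j') \<Rightarrow> A $ i' $ j'
     | (Inl i', Inr j') \<Rightarrow> B $ i' $ j'
     | (Inr i', Inl j') \<Rightarrow> 0
     | (Inr i', Inr j') \<Rightarrow> C $ i' $ j')"

lemma block_mod_eq_block_matrix: "block_mod M N D g = block_matrix (N g) (D g) (M g)"
  by (simp add: block_mod_def block_matrix_def)

lemma block_matrix_mult:
  "block_matrix A B C ** block_matrix A' B' C' = block_matrix (A ** A') (A ** B' + B ** C') (C ** C')"
  unfolding block_matrix_def matrix_matrix_mult_def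
  by (auto simp: vec_eq_iff UNIV_Plus_UNIV[symmetric] sum.Plus simp del: UNIV_Plus_UNIV split: sum.split)

lemma block_matrix_add:
  "block_matrix A B C + block_matrix A' B' C' = block_matrix (A + A') (B + B') (C + C')"
  unfolding block_matrix_def by (auto simp: vec_eq_iff split: sum.split)

lemma zero_eq_block_matrix: "0 = block_matrix 0 0 0"
  unfolding block_matrix_def by (auto simp: vec_eq_iff split: sum.split)

lemma block_matrix_eq_iff:
  "block_matrix A B C = block_matrix A' B' C' \<longleftrightarrow> A = A' \<and> B = B' \<and> C = C'"
proof
  assume "block_matrix A B C = block_matrix A' B' C'"
  then have "\<And>i j. block_matrix A B C $ i $ j = block_matrix A' B' C' $ i $ j" by simp
  then show "A = A' \<and> B = B' \<and> C = C'"
    unfolding block_matrix_def vec_eq_iff by (metis (no_types, lifting) case_prod_conv sum.case vec_lambda_beta)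
qed simp

lemma cocycles_zero_module_iff:
  assumes M: "\<And>g. M g = 0" and "is_umod N"
  shows "D \<in> cocycles M N \<longleftrightarrow>
    N Ga ** D Gb + N Gb ** D Ga = D Gc \<and> N Ga ** D Gc + N Gc ** D Ga = D Ga \<and>
    N Gb ** D Gc + N Gc ** D Gb = D Gb \<and> N Ga ** N Ga ** N Ga ** D Ga = 0 \<and>
    N Gb ** N Gb ** N Gb ** D Gb = 0 \<and> N Gc ** D Gc + D Gc = 0"
  using \<open>is_umod N\<close> unfolding cocycles_def is_umod_def block_mod_eq_block_matrix block_matrix_mult
    block_matrix_add zero_eq_block_matrix block_matrix_eq_iff
  by (simp add: M matrix_mul_assoc)

lemma coboundaries_zero_module:
  assumes "\<And>g. M g = 0"
  shows "coboundaries M N = range (\<lambda>h g. N g ** h)"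
  using assms by (auto simp: coboundaries_def)

lemma columnvector_add: "columnvector (x + y) = columnvector x + columnvector y"
  and columnvector_eq_iff: "columnvector x = columnvector y \<longleftrightarrow> x = y"
  and columnvector_eq_0_iff: "columnvector x = 0 \<longleftrightarrow> x = 0"
  by (auto simp: columnvector_def vec_eq_iff)

lemma extension_cocycle:
  fixes \<rho>U :: "gen \<Rightarrow> 'k::field^'u^'u" and F :: "'k^'n^'u" and N :: "gen \<Rightarrow> 'k^'n^'n"
  assumes "is_umod N" and "is_umod \<rho>U" and "is_umod_hom N \<rho>U F" and "inj ((*v) F)"
    and lift: "\<And>g. \<rho>U g *v u = F *v e g"
  shows "(\<lambda>g. columnvector (e g)) \<in> cocycles (V0 :: gen \<Rightarrow> 'k^1^1) N"
proof -
  have F_eq: "F *v x = F *v y \<longleftrightarrow> x = y" and F_eq_0: "F *v x = 0 \<longleftrightarrow> x = 0" for x y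
    using \<open>inj ((*v) F)\<close> by (auto simp: inj_eq dest: injD[where y = 0])
  from \<open>is_umod \<rho>U\<close> have
    "(\<rho>U Ga ** \<rho>U Gb + \<rho>U Gb ** \<rho>U Ga) *v u = \<rho>U Gc *v u \<and>
     (\<rho>U Ga ** \<rho>U Gc + \<rho>U Gc ** \<rho>U Ga) *v u = \<rho>U Ga *v u \<and>
     (\<rho>U Gb ** \<rho>U Gc + \<rho>U Gc ** \<rho>U Gb) *v u = \<rho>U Gb *v u \<and>
     (\<rho>U Ga ** \<rho>U Ga ** \<rho>U Ga ** \<rho>U Ga) *v u = 0 \<and>
     (\<rho>U Gb ** \<rho>U Gb ** \<rho>U Gb ** \<rho>U Gb) *v u = 0 \<and>
     (\<rho>U Gc ** \<rho>U Gc + \<rho>U Gc) *v u = 0"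
    unfolding is_umod_def by simp
  then show ?thesis
    by (simp add: cocycles_zero_module_iff[OF V0_def \<open>is_umod N\<close>] matrix_vector_mult_add_rdistrib
        lift umod_hom_mult_vec[OF \<open>is_umod_hom N \<rho>U F\<close>] F_eq F_eq_0
        columnvector_eq_iff columnvector_eq_0_iff
        flip: matrix_vector_mul_assoc matrix_vector_right_distrib dot_rowvector_columnvector columnvector_add)
qed

lemma V1_mult_matrix:
  "(V1 Ga ** (X::'k::field^'m^3)) $ i = (if i = 1 then 0 else if i = 2 then X$1 else X$2)"
  "(V1 Gb ** X) $ i = (if i = 1 then X$2 else if i = 2 then X$3 else 0)"
  "(V1 Gc ** X) $ i = (if i = 2 then 0 else X$i)"
  using exhaust_3[of i] by (auto simp: V1_def matrix_matrix_mult_def sum_3 vec_eq_iff)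

lemma V1_mult_vec:
  "V1 Ga *v (x::'k::field^3) = vector [0, x$1, x$2]"
  "V1 Gb *v x = vector [x$2, x$3, 0]"
  "V1 Gc *v x = vector [x$1, 0, x$3]"
  by (auto simp: V1_def matrix_vector_mult_def sum_3 vec_eq_iff forall_3)

lemma is_umod_V1:
  assumes "CHAR('k::field) = 2"
  shows "is_umod (V1 :: gen \<Rightarrow> 'k^3^3)"
  using CHAR_2_imp_two_eq_zero[OF assms] unfolding is_umod_def
  by (simp add: vec_eq_iff forall_3 V1_mult_matrix flip: matrix_mul_assoc) (simp add: V1_def)

lemma cocycles_V0_V1_iff:
  assumes "CHAR('k::field) = 2"
  shows "D \<in> cocycles (V0::gen \<Rightarrow> 'k^1^1) (V1::gen \<Rightarrow> 'k^3^3) \<longleftrightarrow>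
    D Gc$1$1 = D Ga$2$1 \<and> D Gc$2$1 = 0 \<and> D Gb$1$1 = - D Ga$3$1 \<and> D Gc$3$1 = D Gb$2$1"
  using CHAR_2_imp_two_eq_zero[OF assms]
  by (simp add: cocycles_zero_module_iff[OF _ is_umod_V1[OF assms]] V0_def vec_eq_iff forall_3
      V1_mult_matrix flip: matrix_mul_assoc)
    (auto simp: eq_neg_iff_add_eq_0 add.commute)

lemma exhaust_5:
  fixes x :: 5
  shows "x = 1 \<or> x = 2 \<or> x = 3 \<or> x = 4 \<or> x = 5"
proof (induct x)
  case (of_int z)
  then have "z = 0 \<or> z = 1 \<or> z = 2 \<or> z = 3 \<or> z = 4" by fastforce
  then show ?case by auto
qed

definition V1_cocycle :: "'k::field^5 \<Rightarrow> gen \<Rightarrow> 'k^1^3" where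
  "V1_cocycle x g = columnvector (case g of
       Ga \<Rightarrow> vector [x$1, x$2, x$3]
     | Gb \<Rightarrow> vector [- x$3, x$4, x$5]
     | Gc \<Rightarrow> vector [x$2, 0, x$4])"

lemma cocycles_V0_V1:
  assumes "CHAR('k::field) = 2"
  shows "cocycles (V0::gen \<Rightarrow> 'k^1^1) (V1::gen \<Rightarrow> 'k^3^3) = range V1_cocycle"
proof (intro set_eqI iffI)
  fix D :: "gen \<Rightarrow> 'k^1^3"
  assume "D \<in> cocycles V0 V1"
  then have eqs: "D Gc$1$1 = D Ga$2$1" "D Gc$2$1 = 0" "D Gb$1$1 = - D Ga$3$1" "D Gc$3$1 = D Gb$2$1"
    using cocycles_V0_V1_iff[OF assms] by blast+
  define x :: "'k^5" where "x = (\<chi> i. if i = 1 then D Ga$1$1 else if i = 2 then D Ga$2$1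
    else if i = 3 then D Ga$3$1 else if i = 4 then D Gb$2$1 else D Gb$3$1)"
  have "D g = V1_cocycle x g" for g
    using eqs by (cases g) (simp_all add: V1_cocycle_def columnvector_def x_def vec_eq_iff forall_3)
  then have "D = V1_cocycle x" by blast
  then show "D \<in> range V1_cocycle" by blast
next
  fix D :: "gen \<Rightarrow> 'k^1^3"
  assume "D \<in> range V1_cocycle"
  then obtain x where "D = V1_cocycle x" by blast
  then show "D \<in> cocycles V0 V1"
    unfolding cocycles_V0_V1_iff[OF assms] by (simp add: V1_cocycle_def columnvector_def)
qed

lemma V1_cocycle_add: "V1_cocycle (x + y) = V1_cocycle x + V1_cocycle y"
  and V1_cocycle_scale: "V1_cocycle (c *s x) = hom_scale c (V1_cocycle x)"
  by (auto simp: fun_eq_iff V1_cocycle_def hom_scale_def columnvector_def vec_eq_iff forall_3 split: gen.split)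

lemma inj_V1_cocycle: "inj V1_cocycle"
proof (rule injI)
  fix x y :: "'k::field^5"
  assume "V1_cocycle x = V1_cocycle y"
  then have "\<And>g i. V1_cocycle x g $ i $ 1 = V1_cocycle y g $ i $ 1" by simp
  from this[of Ga 1] this[of Ga 2] this[of Ga 3] this[of Gb 2] this[of Gb 3]
  have "x$1 = y$1" "x$2 = y$2" "x$3 = y$3" "x$4 = y$4" "x$5 = y$5"
    by (simp_all add: V1_cocycle_def columnvector_def)
  then have "x$i = y$i" for i
    using exhaust_5[of i] by auto
  then show "x = y"
    by (simp add: vec_eq_iff)
qed

definition V1_coboundary :: "'k::field^3 \<Rightarrow> gen \<Rightarrow> 'k^1^3" where
  "V1_coboundary h g = V1 g ** columnvector h"

lemma coboundaries_V0_V1: "coboundaries (V0::gen \<Rightarrow> 'k::field^1^1) V1 = range V1_coboundary"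
proof -
  have columnvector_column: "columnvector (column 1 h) = h" for h :: "'k^1^3"
    by (simp add: vec_eq_iff columnvector_def column_def)
  have "(\<lambda>(h::'k^1^3) g. V1 g ** h) = V1_coboundary \<circ> column 1"
    by (simp add: fun_eq_iff V1_coboundary_def columnvector_column)
  moreover have "surj (column 1 :: 'k^1^3 \<Rightarrow> 'k^3)"
    by (rule surjI[of _ columnvector]) (simp add: vec_eq_iff columnvector_def column_def)
  ultimately show ?thesis
    by (simp add: coboundaries_zero_module V0_def) (metis image_comp)
qed

lemma V1_coboundary_add: "V1_coboundary (x + y) = V1_coboundary x + V1_coboundary y"
  and V1_coboundary_scale: "V1_coboundary (c *s x) = hom_scale c (V1_coboundary x)"
  by (auto simp: fun_eq_iff V1_coboundary_def hom_scale_def columnvector_def vec_eq_iff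
      matrix_matrix_mult_def sum.distrib sum_distrib_left algebra_simps)

lemma inj_V1_coboundary: "inj V1_coboundary"
proof (rule injI)
  fix x y :: "'k::field^3"
  assume "V1_coboundary x = V1_coboundary y"
  then have "\<And>g i. V1_coboundary x g $ i $ 1 = V1_coboundary y g $ i $ 1" by simp
  from this[of Ga 2] this[of Ga 3] this[of Gb 2]
  show "x = y"
    by (simp add: V1_coboundary_def V1_mult_matrix columnvector_def vec_eq_iff forall_3)
qed

lemma ext1_dim_V0_V1:
  assumes "CHAR('k::field) = 2"
  shows "ext1_dim (V0 :: gen \<Rightarrow> 'k^1^1) (V1 :: gen \<Rightarrow> 'k^3^3) = 2"
  unfolding ext1_dim_def cocycles_V0_V1[OF assms] coboundaries_V0_V1
  by (simp add: dim_range_injective_linear V1_cocycle_add V1_cocycle_scale inj_V1_cocycle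
      V1_coboundary_add V1_coboundary_scale inj_V1_coboundary)

definition Vtlm_cocycle :: "'k::field \<Rightarrow> 'k \<Rightarrow> 'k \<Rightarrow> gen \<Rightarrow> 'k^3" where
  "Vtlm_cocycle th la mu g = (case g of
       Ga \<Rightarrow> vector [th, 0, 0]
     | Gb \<Rightarrow> vector [0, la, mu]
     | Gc \<Rightarrow> vector [0, 0, la])"

lemma extension_normal_form:
  fixes \<rho>U :: "gen \<Rightarrow> 'k::field^'u^'u" and F :: "'k^3^'u" and G :: "'k^'u^1"
  assumes "CHAR('k) = 2" and "is_umod \<rho>U"
    and hom_F: "is_umod_hom V1 \<rho>U F" and hom_G: "is_umod_hom \<rho>U V0 G"
    and "inj ((*v) F)" and "surj ((*v) G)" and exact: "{x. G *v x = 0} = range ((*v) F)"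
  obtains u th la mu where "G *v u = 1" and "\<And>g. \<rho>U g *v u = F *v Vtlm_cocycle th la mu g"
proof -
  obtain u0 where u0: "G *v u0 = 1"
    using \<open>surj ((*v) G)\<close> by (metis surjD)
  have "G *v (\<rho>U g *v u0) = 0" for g
    using hom_G by (simp add: is_umod_hom_def V0_def matrix_vector_mul_assoc flip: matrix_mul_assoc)
  then have "\<forall>g. \<exists>w. \<rho>U g *v u0 = F *v w"
    using exact by blast
  then obtain d where d: "\<And>g. \<rho>U g *v u0 = F *v d g"
    by metis
  have GF: "G *v (F *v w) = 0" for w
    using exact by blast
  \<comment> \<open>Correcting the lift by a coboundary kills the last two entries of its image under a.\<close>
  define h :: "'k^3" where "h = vector [- d Ga $ 2, - d Ga $ 3, 0]"
  define u where "u = u0 + F *v h"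
  define e where "e g = d g + V1 g *v h" for g
  have lift: "\<rho>U g *v u = F *v e g" for g
    by (simp add: u_def e_def matrix_vector_right_distrib d umod_hom_mult_vec[OF hom_F])
  have "(\<lambda>g. columnvector (e g)) \<in> cocycles (V0 :: gen \<Rightarrow> 'k^1^1) V1"
    using extension_cocycle is_umod_V1 assms lift by blast
  then have eqs: "e Gc$1 = e Ga$2" "e Gc$2 = 0" "e Gb$1 = - e Ga$3" "e Gc$3 = e Gb$2"
    by (simp_all add: cocycles_V0_V1_iff[OF \<open>CHAR('k) = 2\<close>] columnvector_def)
  have "e Ga = vector [d Ga $ 1, 0, 0]"
    by (simp add: e_def h_def V1_mult_vec vec_eq_iff forall_3)
  with eqs have "e g = Vtlm_cocycle (d Ga $ 1) (e Gb $ 2) (e Gb $ 3) g" for g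
    by (cases g) (auto simp: Vtlm_cocycle_def vec_eq_iff forall_3)
  moreover have "G *v u = 1"
    by (simp add: u_def matrix_vector_right_distrib u0 GF)
  ultimately show thesis
    using that lift by metis
qed

definition vec_tail :: "'k^4 \<Rightarrow> 'k^3" where
  "vec_tail y = (\<chi> i. if i = 1 then y$2 else if i = 2 then y$3 else y$4)"

lemma vec_tail_add: "vec_tail (x + y) = vec_tail x + vec_tail y"
  and vec_tail_scale: "vec_tail (c *s x) = c *s vec_tail x"
  by (auto simp: vec_tail_def vec_eq_iff)

lemma Vtlm_mult_vec:
  "Vtlm th la mu Ga *v y = (\<chi> i. if i = 2 then th * y$1 else if i = 3 then y$2 else if i = 4 then y$3 else 0)"
  "Vtlm th la mu Gb *v y =
     (\<chi> i. if i = 2 then y$3 else if i = 3 then la * y$1 + y$4 else if i = 4 then mu * y$1 else 0)"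
  "Vtlm th la mu Gc *v y = (\<chi> i. if i = 2 then y$2 else if i = 4 then la * y$1 + y$4 else 0)"
  by (auto simp: Vtlm_def matrix_vector_mult_def sum_4 vec_eq_iff forall_4)

lemma Vtlm_mult_vec_head: "(Vtlm th la mu g *v y) $ 1 = 0"
  by (cases g) (simp_all add: Vtlm_mult_vec)

lemma Vtlm_mult_vec_tail:
  "vec_tail (Vtlm th la mu g *v y) = y$1 *s Vtlm_cocycle th la mu g + V1 g *v vec_tail y"
  by (cases g) (auto simp: Vtlm_mult_vec Vtlm_cocycle_def V1_mult_vec vec_tail_def vec_eq_iff forall_3 mult.commute)

lemma bij_extension_coordinates:
  fixes F :: "'k::field^3^'u" and G :: "'k^'u^1"
  assumes "inj ((*v) F)" and exact: "{x. G *v x = 0} = range ((*v) F)" and "G *v u = 1"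
  shows "bij (\<lambda>y::'k^4. y$1 *s u + F *v vec_tail y)" (is "bij ?f")
proof (rule bijI)
  have GF: "G *v (F *v w) = 0" for w
    using exact by blast
  have G_f: "G *v ?f y = vec (y$1)" for y
    by (simp add: matrix_vector_right_distrib vector_scalar_commute \<open>G *v u = 1\<close> GF vec_eq_iff)
  show "inj ?f"
  proof (rule injI)
    fix x y :: "'k^4"
    assume f_eq: "?f x = ?f y"
    then have "(G *v ?f x) $ 1 = (G *v ?f y) $ 1"
      by simp
    then have "x$1 = y$1"
      by (simp only: G_f vec_component)
    with f_eq have "F *v vec_tail x = F *v vec_tail y"
      by simp
    then have "vec_tail x = vec_tail y"
      using \<open>inj ((*v) F)\<close> by (simp add: inj_eq)
    then have "x$i = y$i" if "i \<noteq> 1" for i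
      using that exhaust_4[of i] by (auto simp: vec_tail_def vec_eq_iff forall_3)
    with \<open>x$1 = y$1\<close> show "x = y"
      by (metis vec_eq_iff)
  qed
  show "surj ?f"
    unfolding surj_def
  proof
    fix z
    define t where "t = (G *v z) $ 1"
    have "G *v (z - t *s u) = 0"
      by (simp add: matrix_vector_mult_diff_distrib vector_scalar_commute \<open>G *v u = 1\<close> vec_eq_iff t_def)
    then obtain w where w: "z - t *s u = F *v w"
      using exact by blast
    define y :: "'k^4" where "y = (\<chi> i. if i = 1 then t else if i = 2 then w$1 else if i = 3 then w$2 else w$3)"
    have "vec_tail y = w"
      by (simp add: vec_tail_def y_def vec_eq_iff forall_3)
    then have "?f y = z"
      using w by (simp add: y_def algebra_simps)
    then show "\<exists>y. z = ?f y"
      by metis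
  qed
qed

lemma extension_iso_Vtlm:
  fixes \<rho>U :: "gen \<Rightarrow> 'k::field^'u^'u" and F :: "'k^3^'u" and G :: "'k^'u^1"
  assumes "CHAR('k) = 2" and "is_umod \<rho>U"
    and hom_F: "is_umod_hom V1 \<rho>U F" and "is_umod_hom \<rho>U V0 G"
    and "inj ((*v) F)" and "surj ((*v) G)" and "{x. G *v x = 0} = range ((*v) F)"
  shows "\<exists>th la mu. umod_iso (Vtlm th la mu) \<rho>U"
proof -
  obtain u th la mu where "G *v u = 1" and lift: "\<And>g. \<rho>U g *v u = F *v Vtlm_cocycle th la mu g"
    using extension_normal_form assms by blast
  define f where "f y = y$1 *s u + F *v vec_tail y" for y :: "'k^4"
  have "Vector_Spaces.linear (*s) (*s) f"
    by (auto simp: Vector_Spaces.linear_iff vec.vector_space_axioms f_def vec_tail_add vec_tail_scale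
        matrix_vector_right_distrib vector_scalar_commute algebra_simps)
  then have P: "(*v) (matrix f) = f"
    using matrix_works by blast
  have "bij f"
    unfolding f_def using bij_extension_coordinates assms \<open>G *v u = 1\<close> by blast
  have "\<rho>U g *v f y = f (Vtlm th la mu g *v y)" for g y
    by (simp add: f_def Vtlm_mult_vec_head Vtlm_mult_vec_tail matrix_vector_right_distrib
        vector_scalar_commute lift umod_hom_mult_vec[OF hom_F])
  then have "matrix f ** Vtlm th la mu g = \<rho>U g ** matrix f" for g
    by (simp add: matrix_eq P flip: matrix_vector_mul_assoc)
  moreover have "invertible (matrix f)"
    using \<open>bij f\<close> by (simp add: invertible_eq_bij P)
  ultimately show ?thesis
    unfolding umod_iso_def is_umod_hom_def by blast
qed

theorem lemma3p6:
  fixes \<rho>U :: "gen \<Rightarrow> 'k::alg_closed_field ^'u^'u"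
    and F :: "'k^3^'u" and G :: "'k^'u^1"
  assumes "CHAR('k) = 2"
    and "is_umod \<rho>U"
    and "is_umod_hom V1 \<rho>U F" and "is_umod_hom \<rho>U V0 G"
    and "inj ((*v) F)" and "surj ((*v) G)"
    and "{x. G *v x = 0} = range ((*v) F)"
  shows "(\<exists>th la mu. umod_iso \<rho>U (Vtlm th la mu))
         \<and> ext1_dim (V0 :: gen \<Rightarrow> 'k^1^1) (V1 :: gen \<Rightarrow> 'k^3^3) = 2"
  using extension_iso_Vtlm[OF assms] umod_iso_sym ext1_dim_V0_V1[OF assms(1)] by blast

end
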